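(* Let $A=(a_{ij})_{1\le i,j\le n}$ be a real $n\times n$ matrix which is type-I staircase and almost strictly sign regular (ASSR). Then $A$ is irreducible if and only if $a_{j+1,j}\neq 0$ and $a_{j,j+1}\neq 0$ for all $j=1,\dots,n-1$.
   Context: For $\alpha,\beta\in Q_{m,n}$ (increasing sequences of $m$ integers in $\{1,\dots,n\}$), $A[\alpha|\beta]$ denotes the submatrix with rows $\alpha$ and columns $\beta$. A real matrix $A=(a_{ij})$ is type-I staircase if: (i) $a_{ii}\neq 0$ for all $i$; (ii) if $a_{ij}=0$ with $i>j$, then $a_{kl}=0$ for all $l\le j$, $k\ge i$; (iii) if $a_{ij}=0$ with $i<j$, then $a_{kl}=0$ for all $k\le i$, $l\ge j$. It is type-II staircase if: (i) $a_{i,n-i+1}\neq 0$ for all $i$; (ii) if $a_{ij}=0$ with $j>n-i+1$, then $a_{kl}=0$ for all $k\ge i$, $l\ge j$; (iii) if $a_{ij}=0$ with $j<n-i+1$, then $a_{kl}=0$ for all $k\le i$, $l\le j$. For a type-I (resp. type-II) staircase matrix, a submatrix $A[\alpha|\beta]$ with $\alpha,\beta\in Q_{m,n}$ is nontrivial if $a_{\alpha_i\beta_i}\neq0$ (resp. $a_{\alpha_i\beta_{m-i+1}}\neq 0$) for all $i=1,\dots,m$. A signature is a vector $\varepsilon=(\varepsilon_1,\dots,\varepsilon_n)$ with $\varepsilon_i\in\{+1,-1\}$. $A$ is ASSR with signature $\varepsilon$ if it is type-I or type-II staircase and $\varepsilon_m\det A[\alpha|\beta]>0$ for every nontrivial submatrix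 $A[\alpha|\beta]$, $\alpha,\beta\in Q_{m,n}$, $m\le n$. A square matrix $A$ is reducible if there is a permutation matrix $P$ with $PAP^T=\begin{pmatrix}B&0\\ C&D\end{pmatrix}$ with $B,D$ square (nonempty); otherwise it is irreducible. *)

theory Defs
  imports "Jordan_Normal_Form.Determinant" "Jordan_Normal_Form.DL_Submatrix"
begin

text \<open>
  Matrix, vector and list indices start at 0: the entry usually written \<open>a\<^sub>i\<^sub>j\<close>
  with \<open>1 \<le> i, j \<le> n\<close> is \<open>A $$ (i - 1, j - 1)\<close>.  In particular the antidiagonal
  \<open>j = n - i + 1\<close> becomes \<open>i + j = n - 1\<close>, i.e.\ \<open>i + j + 1 = n\<close>.
\<close>

definition incr_seqs :: "nat \<Rightarrow> nat \<Rightarrow> nat list set" where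
  "incr_seqs m n = {\<alpha>. length \<alpha> = m \<and> sorted_wrt (<) \<alpha> \<and> set \<alpha> \<subseteq> {..<n}}"

text \<open>
  The submatrix \<open>A[\<alpha>|\<beta>]\<close>.  The library function takes the rows and columns as sets and
  lists them in increasing order, so no information about \<open>\<alpha>\<close>, \<open>\<beta>\<close> is lost; see
  \<open>submatrix_of_index\<close> below.
\<close>

definition submatrix_of :: "'a mat \<Rightarrow> nat list \<Rightarrow> nat list \<Rightarrow> 'a mat" where
  "submatrix_of A \<alpha> \<beta> = submatrix A (set \<alpha>) (set \<beta>)"

lemma incr_seq_pick:
  assumes "sorted_wrt (<) \<alpha>" and "i < length \<alpha>"
  shows "pick (set \<alpha>) i = \<alpha> ! i"
proof -
  have inj: "inj_on ((!) \<alpha>) {..<i}"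
    using assms by (intro inj_onI) (metis lessThan_iff less_trans nat_neq_iff sorted_wrt_nth_less)
  have "{a \<in> set \<alpha>. a < \<alpha> ! i} = (!) \<alpha> ` {..<i}"
  proof (intro equalityI subsetI)
    fix a assume a: "a \<in> {a \<in> set \<alpha>. a < \<alpha> ! i}"
    then obtain k where k: "k < length \<alpha>" "a = \<alpha> ! k" by (auto simp: in_set_conv_nth)
    have "k < i"
    proof (rule ccontr)
      assume "\<not> k < i"
      then have "\<alpha> ! i \<le> \<alpha> ! k"
        using assms k by (metis less_imp_le nat_neq_iff order_refl sorted_wrt_nth_less)
      then show False using a k by simp
    qed
    then show "a \<in> (!) \<alpha> ` {..<i}" using k by simp
  next
    fix a assume "a \<in> (!) \<alpha> ` {..<i}"
    then show "a \<in> {a \<in> set \<alpha>. a < \<alpha> ! i}"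
      using assms sorted_wrt_nth_less[OF assms(1)] by auto
  qed
  then have "card {a \<in> set \<alpha>. a < \<alpha> ! i} = i"
    using card_image[OF inj] by simp
  moreover have "\<alpha> ! i \<in> set \<alpha>" using assms by simp
  ultimately show ?thesis using pick_card_in_set by metis
qed

lemma submatrix_of_carrier:
  assumes "A \<in> carrier_mat n n" and "\<alpha> \<in> incr_seqs m n" and "\<beta> \<in> incr_seqs m n"
  shows "submatrix_of A \<alpha> \<beta> \<in> carrier_mat m m"
proof -
  have "card {i. i < n \<and> i \<in> set \<gamma>} = m" if "\<gamma> \<in> incr_seqs m n" for \<gamma>
  proof -
    have "{i. i < n \<and> i \<in> set \<gamma>} = set \<gamma>" using that by (auto simp: incr_seqs_def)
    then show ?thesis using that
      by (simp add: incr_seqs_def distinct_card strict_sorted_iff)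
  qed
  then show ?thesis using assms
    by (intro carrier_matI) (simp_all add: submatrix_of_def dim_submatrix)
qed

lemma submatrix_of_index:
  assumes "A \<in> carrier_mat n n" and "\<alpha> \<in> incr_seqs m n" and "\<beta> \<in> incr_seqs m n"
    and "i < m" and "j < m"
  shows "submatrix_of A \<alpha> \<beta> $$ (i, j) = A $$ (\<alpha> ! i, \<beta> ! j)"
proof -
  have "submatrix_of A \<alpha> \<beta> $$ (i, j) = A $$ (pick (set \<alpha>) i, pick (set \<beta>) j)"
    using submatrix_of_carrier[OF assms(1-3)] assms(4,5)
    unfolding submatrix_of_def by (intro submatrix_index) (auto simp: dim_submatrix)
  then show ?thesis using assms by (simp add: incr_seqs_def incr_seq_pick)
qed

definition staircase_I :: "nat \<Rightarrow> real mat \<Rightarrow> bool" where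
  "staircase_I n A \<longleftrightarrow> A \<in> carrier_mat n n
    \<and> (\<forall>i<n. A $$ (i, i) \<noteq> 0)
    \<and> (\<forall>i<n. \<forall>j<n. A $$ (i, j) = 0 \<and> i > j \<longrightarrow>
          (\<forall>k<n. \<forall>l<n. l \<le> j \<and> k \<ge> i \<longrightarrow> A $$ (k, l) = 0))
    \<and> (\<forall>i<n. \<forall>j<n. A $$ (i, j) = 0 \<and> i < j \<longrightarrow>
          (\<forall>k<n. \<forall>l<n. k \<le> i \<and> l \<ge> j \<longrightarrow> A $$ (k, l) = 0))"

definition staircase_II :: "nat \<Rightarrow> real mat \<Rightarrow> bool" where
  "staircase_II n A \<longleftrightarrow> A \<in> carrier_mat n n
    \<and> (\<forall>i<n. A $$ (i, n - 1 - i) \<noteq> 0)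
    \<and> (\<forall>i<n. \<forall>j<n. A $$ (i, j) = 0 \<and> j > n - 1 - i \<longrightarrow>
          (\<forall>k<n. \<forall>l<n. k \<ge> i \<and> l \<ge> j \<longrightarrow> A $$ (k, l) = 0))
    \<and> (\<forall>i<n. \<forall>j<n. A $$ (i, j) = 0 \<and> j < n - 1 - i \<longrightarrow>
          (\<forall>k<n. \<forall>l<n. k \<le> i \<and> l \<le> j \<longrightarrow> A $$ (k, l) = 0))"

definition nontrivial_I :: "nat \<Rightarrow> real mat \<Rightarrow> nat list \<Rightarrow> nat list \<Rightarrow> bool" where
  "nontrivial_I m A \<alpha> \<beta> \<longleftrightarrow> (\<forall>i<m. A $$ (\<alpha> ! i, \<beta> ! i) \<noteq> 0)"

definition nontrivial_II :: "nat \<Rightarrow> real mat \<Rightarrow> nat list \<Rightarrow> nat list \<Rightarrow> bool" where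
  "nontrivial_II m A \<alpha> \<beta> \<longleftrightarrow> (\<forall>i<m. A $$ (\<alpha> ! i, \<beta> ! (m - 1 - i)) \<noteq> 0)"

definition signature :: "nat \<Rightarrow> real vec \<Rightarrow> bool" where
  "signature n \<epsilon> \<longleftrightarrow> \<epsilon> \<in> carrier_vec n \<and> (\<forall>i<n. \<epsilon> $ i \<in> {1, -1})"

text \<open>
  A matrix that is staircase of both types has no zero entry, so the two notions of
  nontriviality agree for it and the disjuncts below do not conflict.
\<close>

definition ASSR_with :: "nat \<Rightarrow> real mat \<Rightarrow> real vec \<Rightarrow> bool" where
  "ASSR_with n A \<epsilon> \<longleftrightarrow> signature n \<epsilon> \<and>
    (staircase_I n A \<and>
       (\<forall>m\<in>{1..n}. \<forall>\<alpha>\<in>incr_seqs m n. \<forall>\<beta>\<in>incr_seqs m n. nontrivial_I m A \<alpha> \<beta> \<longrightarrow>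
          \<epsilon> $ (m - 1) * det (submatrix_of A \<alpha> \<beta>) > 0)
     \<or> staircase_II n A \<and>
       (\<forall>m\<in>{1..n}. \<forall>\<alpha>\<in>incr_seqs m n. \<forall>\<beta>\<in>incr_seqs m n. nontrivial_II m A \<alpha> \<beta> \<longrightarrow>
          \<epsilon> $ (m - 1) * det (submatrix_of A \<alpha> \<beta>) > 0))"

definition ASSR :: "nat \<Rightarrow> real mat \<Rightarrow> bool" where
  "ASSR n A \<longleftrightarrow> (\<exists>\<epsilon>. ASSR_with n A \<epsilon>)"

definition permutation_mat :: "nat \<Rightarrow> 'a :: {zero, one} mat \<Rightarrow> bool" where
  "permutation_mat n P \<longleftrightarrow>
    (\<exists>p. p permutes {..<n} \<and> P = mat n n (\<lambda>(i, j). if j = p i then 1 else 0))"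

definition reducible_mat :: "nat \<Rightarrow> 'a :: semiring_1 mat \<Rightarrow> bool" where
  "reducible_mat n A \<longleftrightarrow>
    (\<exists>P r s B C D. permutation_mat n P \<and> r > 0 \<and> s > 0 \<and>
       B \<in> carrier_mat r r \<and> C \<in> carrier_mat s r \<and> D \<in> carrier_mat s s \<and>
       P * A * transpose_mat P = four_block_mat B (0\<^sub>m r s) C D)"

abbreviation irreducible_mat :: "nat \<Rightarrow> 'a :: semiring_1 mat \<Rightarrow> bool" where
  "irreducible_mat n A \<equiv> \<not> reducible_mat n A"

end

theory Submission
  imports Defs
begin

text \<open>
  Reducibility means that some nonempty proper index set \<open>S\<close> is closed under the relation
  \<open>a\<^sub>i\<^sub>j \<noteq> 0\<close>.  If all sub- and superdiagonal entries are nonzero, a closed set contains the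
  neighbours of each of its elements, hence is everything.  Conversely, by the staircase
  shape a zero at \<open>(j, j + 1)\<close> makes the initial segment ending in \<open>j\<close> closed, and a zero at
  \<open>(j + 1, j)\<close> makes the complementary final segment closed.
\<close>

text \<open>Row \<open>i\<close> of \<open>P\<close> is the unit vector at \<open>p i\<close>, so
  multiplying by \<open>P\<close> on the left picks row \<open>p i\<close> of \<open>A\<close>, and
  multiplying by its transpose on the right picks column \<open>p j\<close>.\<close>

lemma permutation_conj_index:
  fixes A :: "'a :: semiring_1 mat"
  assumes A: "A \<in> carrier_mat n n" and p: "p permutes {..<n}"
    and P: "P = mat n n (\<lambda>(i, j). if j = p i then 1 else 0)"
    and ij: "i < n" "j < n"
  shows "(P * A * transpose_mat P) $$ (i, j) = A $$ (p i, p j)"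
proof -
  have pn: "p k < n" if "k < n" for k
    using permutes_in_image[OF p, of k] that by simp
  have PA: "(P * A) $$ (i, k) = A $$ (p i, k)" if k: "k < n" for k
  proof -
    have "(P * A) $$ (i, k) = (\<Sum>l = 0..<n. (if l = p i then 1 else 0) * A $$ (l, k))"
      using A ij k by (simp add: P scalar_prod_def)
    also have "\<dots> = (\<Sum>l = 0..<n. if l = p i then A $$ (l, k) else 0)"
      by (rule sum.cong) auto
    finally show ?thesis using pn[OF ij(1)] by simp
  qed
  have "(P * A * transpose_mat P) $$ (i, j) = row (P * A) i \<bullet> row P j"
    using A ij by (simp add: P)
  also have "\<dots> = (\<Sum>l = 0..<n. (P * A) $$ (i, l) * (if l = p j then 1 else 0))"
    using A ij unfolding scalar_prod_def by (intro sum.cong) (simp_all add: P)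
  also have "\<dots> = (\<Sum>l = 0..<n. if l = p j then A $$ (p i, l) else 0)"
    by (rule sum.cong) (auto simp: PA)
  finally show ?thesis using pn[OF ij(2)] by simp
qed

text \<open>Provides the simultaneous reordering of rows and columns that moves \<open>S\<close> to
  the front. Equal cardinalities give one bijection onto \<open>S\<close> and one onto its
  complement, which are then glued.\<close>

lemma obtain_permutes_initial_segment:
  assumes "S \<subseteq> {..<n :: nat}"
  obtains p where "p permutes {..<n}" "p ` {..<card S} = S" "p ` {card S..<n} = {..<n} - S"
proof -
  let ?r = "card S"
  have fin: "finite S" using assms finite_subset by blast
  have rn: "?r \<le> n" using card_mono[OF _ assms] by simp
  obtain f where f: "bij_betw f {..<?r} S"
    using finite_same_card_bij[of "{..<?r}" S] fin by auto
  have "card {?r..<n} = card ({..<n} - S)" using card_Diff_subset[OF fin assms] by simp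
  then obtain g where g: "bij_betw g {?r..<n} ({..<n} - S)"
    using finite_same_card_bij[of "{?r..<n}" "{..<n} - S"] by auto
  \<comment> \<open>The last branch fixes everything outside \<open>{..<n}\<close>, as
    \<open>permutes\<close> demands.\<close>
  define p where "p i = (if i < ?r then f i else if i < n then g i else i)" for i
  have pf: "bij_betw p {..<?r} S"
    using f by (subst bij_betw_cong[of _ _ f]) (auto simp: p_def)
  have pg: "bij_betw p {?r..<n} ({..<n} - S)"
    using g by (subst bij_betw_cong[of _ _ g]) (auto simp: p_def)
  have "bij_betw p ({..<?r} \<union> {?r..<n}) (S \<union> ({..<n} - S))"
    by (rule bij_betw_combine[OF pf pg]) auto
  moreover have "{..<?r} \<union> {?r..<n} = {..<n}" "S \<union> ({..<n} - S) = {..<n}"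
    using rn assms by auto
  ultimately have "p permutes {..<n}"
    using rn by (intro bij_imp_permutes) (auto simp: p_def)
  then show thesis
    using that pf pg by (auto simp: bij_betw_def)
qed

text \<open>The zero block of the conjugated matrix consists of the entries of \<open>A\<close> with
  row in \<open>p\<close> {..<r}\<open>and column in\<close>p \<open>{r..<n}\<close>. So
  \<open>S\<close> is the image of the first \<open>r\<close> positions, and \<open>r > 0\<close>,
  \<open>s > 0\<close> say that \<open>S\<close> is nonempty and proper.\<close>

lemma reducible_mat_iff_closed_index_set:
  fixes A :: "'a :: semiring_1 mat"
  assumes A: "A \<in> carrier_mat n n"
  shows "reducible_mat n A \<longleftrightarrow>
    (\<exists>S. S \<noteq> {} \<and> S \<subset> {..<n} \<and> (\<forall>i\<in>S. \<forall>j\<in>{..<n} - S. A $$ (i, j) = 0))"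
proof
  assume "reducible_mat n A"
  then obtain P r s B C D where P: "permutation_mat n P" and rs: "r > 0" "s > 0"
    and BCD: "B \<in> carrier_mat r r" "C \<in> carrier_mat s r" "D \<in> carrier_mat s s"
    and eq: "P * A * transpose_mat P = four_block_mat B (0\<^sub>m r s) C D"
    unfolding reducible_mat_def by blast
  obtain p where p: "p permutes {..<n}"
    and Pp: "P = mat n n (\<lambda>(i, j). if j = p i then 1 else 0)"
    using P unfolding permutation_mat_def by blast
  have n: "n = r + s"
    using arg_cong[OF eq, of dim_row] BCD by (simp add: Pp)
  let ?S = "p ` {..<r}"
  have img: "p ` {..<n} = {..<n}" using p by (rule permutes_image)
  have compl: "{..<n} - ?S = p ` {r..<n}"
  proof -
    have "{..<n} - ?S = p ` ({..<n} - {..<r})"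
      using image_set_diff[OF permutes_inj[OF p]] img by metis
    moreover have "{..<n} - {..<r} = {r..<n}" by auto
    ultimately show ?thesis by simp
  qed
  \<comment> \<open>Position \<open>(i, j)\<close> lies in the upper right block, which is zero by
    \<open>eq\<close>.\<close>
  have "A $$ (p i, p j) = 0" if "i < r" "r \<le> j" "j < n" for i j
    using permutation_conj_index[OF A p Pp, of i j] that BCD n by (simp add: eq)
  then have "\<forall>i\<in>?S. \<forall>j\<in>{..<n} - ?S. A $$ (i, j) = 0"
    unfolding compl by auto
  moreover have "?S \<subseteq> {..<n}" using n img by (metis image_mono lessThan_subset_iff le_add1)
  moreover have "{..<n} - ?S \<noteq> {}" unfolding compl using n rs by auto
  moreover have "?S \<noteq> {}" using rs by auto
  ultimately show "\<exists>S. S \<noteq> {} \<and> S \<subset> {..<n} \<and> (\<forall>i\<in>S. \<forall>j\<in>{..<n} - S. A $$ (i, j) = 0)"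
    by (intro exI[of _ ?S]) blast
next
  assume "\<exists>S. S \<noteq> {} \<and> S \<subset> {..<n} \<and> (\<forall>i\<in>S. \<forall>j\<in>{..<n} - S. A $$ (i, j) = 0)"
  then obtain S where S: "S \<noteq> {}" "S \<subset> {..<n}"
    and zero: "\<And>i j. i \<in> S \<Longrightarrow> j \<in> {..<n} - S \<Longrightarrow> A $$ (i, j) = 0" by blast
  define r where "r = card S"
  have r0: "r > 0" using S finite_subset[of S "{..<n}"] by (auto simp: r_def card_gt_0_iff)
  have rn: "r < n" using psubset_card_mono[OF _ S(2)] by (simp add: r_def)
  obtain p where p: "p permutes {..<n}" and pS: "p ` {..<r} = S"
    and pC: "p ` {r..<n} = {..<n} - S"
    using obtain_permutes_initial_segment[of S n] S unfolding r_def by blast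
  define P :: "'a mat" where "P = mat n n (\<lambda>(i, j). if j = p i then 1 else 0)"
  \<comment> \<open>The other three blocks are cut out of \<open>?M\<close> itself, so only the
    vanishing of the upper right one needs an argument.\<close>
  let ?M = "P * A * transpose_mat P"
  let ?B = "mat r r (\<lambda>(i, j). ?M $$ (i, j))"
  let ?C = "mat (n - r) r (\<lambda>(i, j). ?M $$ (i + r, j))"
  let ?D = "mat (n - r) (n - r) (\<lambda>(i, j). ?M $$ (i + r, j + r))"
  have M0: "?M $$ (i, j) = 0" if "i < r" "r \<le> j" "j < n" for i j
  proof -
    have "p i \<in> p ` {..<r}" "p j \<in> p ` {r..<n}" using that by auto
    then have "p i \<in> S" "p j \<in> {..<n} - S" by (simp_all only: pS pC)
    then show ?thesis using permutation_conj_index[OF A p P_def, of i j] that rn zero by simp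
  qed
  have "?M = four_block_mat ?B (0\<^sub>m r (n - r)) ?C ?D"
  proof (rule eq_matI)
    fix i j
    assume "i < dim_row (four_block_mat ?B (0\<^sub>m r (n - r)) ?C ?D)"
      and "j < dim_col (four_block_mat ?B (0\<^sub>m r (n - r)) ?C ?D)"
    then have ij: "i < n" "j < n" using rn by auto
    \<comment> \<open>Removing \<open>index_mult_mat\<close> keeps the entries of \<open>?M\<close>
      from being expanded into scalar products, so that \<open>M0\<close> still applies.\<close>
    then show "?M $$ (i, j) = four_block_mat ?B (0\<^sub>m r (n - r)) ?C ?D $$ (i, j)"
      using rn M0[of i j] by (simp del: index_mult_mat)
  qed (use rn in \<open>auto simp: P_def\<close>)
  moreover have "permutation_mat n P" unfolding permutation_mat_def using p P_def by blast
  ultimately show "reducible_mat n A"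
    unfolding reducible_mat_def using r0 rn
    by (intro exI[of _ P] exI[of _ r] exI[of _ "n - r"] exI[of _ ?B] exI[of _ ?C] exI[of _ ?D])
      (simp del: index_mult_mat)
qed

text \<open>From any element one descends to 0 by \<open>down\<close>, and from 0 one climbs to
  every index by \<open>up\<close>.\<close>

lemma neighbour_closed_eq_lessThan:
  fixes S :: "nat set"
  assumes "S \<noteq> {}" and "S \<subseteq> {..<n}"
    and up: "\<And>j. j + 1 < n \<Longrightarrow> j \<in> S \<Longrightarrow> j + 1 \<in> S"
    and down: "\<And>j. j + 1 < n \<Longrightarrow> j + 1 \<in> S \<Longrightarrow> j \<in> S"
  shows "S = {..<n}"
proof -
  obtain k where k: "k \<in> S" "k < n" using assms(1,2) by blast
  have "0 \<in> S" using k
  proof (induction k)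
    case (Suc k)
    then show ?case using down[of k] by simp
  qed simp
  have "i < n \<Longrightarrow> i \<in> S" for i
  proof (induction i)
    case (Suc i)
    then show ?case using up[of i] by simp
  qed (simp add: \<open>0 \<in> S\<close>)
  then show ?thesis using assms(2) by auto
qed

theorem theorem1:
  fixes n :: nat and A :: "real mat"
  assumes "n \<ge> 1"
    and "A \<in> carrier_mat n n"
    and "staircase_I n A"
    and "ASSR n A"
  shows "irreducible_mat n A \<longleftrightarrow>
    (\<forall>j. j + 1 < n \<longrightarrow> A $$ (j + 1, j) \<noteq> 0 \<and> A $$ (j, j + 1) \<noteq> 0)"
proof
  assume irr: "irreducible_mat n A"
  have no_closed: False
    if "S \<noteq> {}" "S \<subset> {..<n}" "\<And>i j. i \<in> S \<Longrightarrow> j < n \<Longrightarrow> j \<notin> S \<Longrightarrow> A $$ (i, j) = 0" for S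
    using irr that reducible_mat_iff_closed_index_set[OF assms(2)] by auto
  show "\<forall>j. j + 1 < n \<longrightarrow> A $$ (j + 1, j) \<noteq> 0 \<and> A $$ (j, j + 1) \<noteq> 0"
  proof (intro allI impI conjI notI)
    fix j assume j: "j + 1 < n" and z: "A $$ (j + 1, j) = 0"
    \<comment> \<open>The staircase condition below the diagonal spreads the zero to exactly the
      block with rows in \<open>{j + 1..<n}\<close> and columns in its complement
      \<open>{..j}\<close>.\<close>
    have low: "A $$ (k, l) = 0" if "k < n" "l \<le> j" "j + 1 \<le> k" for k l
    proof -
      have "\<forall>k<n. \<forall>l<n. l \<le> j \<and> k \<ge> j + 1 \<longrightarrow> A $$ (k, l) = 0"
        using assms(3) j z unfolding staircase_I_def by (meson add_lessD1 less_add_one)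
      then show ?thesis using that j by simp
    qed
    have "0 \<in> {..<n} - {j + 1..<n}" using j by simp
    then have "{j + 1..<n} \<subset> {..<n}" by fastforce
    moreover have "{j + 1..<n} \<noteq> {}" using j by simp
    ultimately show False
      using no_closed[of "{j + 1..<n}"] low by simp
  next
    fix j assume j: "j + 1 < n" and z: "A $$ (j, j + 1) = 0"
    \<comment> \<open>Above the diagonal the roles swap: rows in \<open>{..j}\<close>, columns in
      \<open>{j + 1..<n}\<close>.\<close>
    have upp: "A $$ (k, l) = 0" if "l < n" "k \<le> j" "j + 1 \<le> l" for k l
    proof -
      have "\<forall>k<n. \<forall>l<n. k \<le> j \<and> l \<ge> j + 1 \<longrightarrow> A $$ (k, l) = 0"
        using assms(3) j z unfolding staircase_I_def by (meson add_lessD1 less_add_one)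
      then show ?thesis using that j by simp
    qed
    have "j + 1 \<in> {..<n} - {..j}" using j by simp
    moreover have "{..j} \<subseteq> {..<n}" using j by auto
    ultimately have "{..j} \<subset> {..<n}" by blast
    then show False
      using no_closed[of "{..j}"] upp by simp
  qed
next
  assume nz: "\<forall>j. j + 1 < n \<longrightarrow> A $$ (j + 1, j) \<noteq> 0 \<and> A $$ (j, j + 1) \<noteq> 0"
  show "irreducible_mat n A"
  proof
    assume "reducible_mat n A"
    then obtain S where S: "S \<noteq> {}" "S \<subset> {..<n}"
      and zero: "\<And>i j. i \<in> S \<Longrightarrow> j \<in> {..<n} - S \<Longrightarrow> A $$ (i, j) = 0"
      unfolding reducible_mat_iff_closed_index_set[OF assms(2)] by blast
    \<comment> \<open>A nonzero entry carries membership from its row index to its column index: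
      superdiagonal entries give the upward step, subdiagonal ones the downward step.\<close>
    have closed: "j \<in> S" if "i \<in> S" "j < n" "A $$ (i, j) \<noteq> 0" for i j
      using zero that by auto
    have "S = {..<n}"
    proof (rule neighbour_closed_eq_lessThan)
      show "j + 1 \<in> S" if "j + 1 < n" "j \<in> S" for j
        using closed[of j "j + 1"] nz that by blast
      show "j \<in> S" if "j + 1 < n" "j + 1 \<in> S" for j
        using closed[of "j + 1" j] nz that by (meson add_lessD1)
    qed (use S in auto)
    then show False using S by blast
  qed
qed

end
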